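(* For real $t\ge 2$ and $c\in\mathbb{C}$ let $F_{t,c}(z)=z^t+c$, where $z^t=e^{t\,\mathrm{Ln}(z)}$ with $\mathrm{Ln}$ the principal branch of the logarithm. Let $K(F_{t,c})$, $J(F_{t,c})$ and $M_t(F)$ be the associated filled Julia set, Julia set and Mandelbrot set. Then, in the Hausdorff metric, as $t\to\infty$ through the real numbers: (a) $\lim_{t\to\infty}M_t(F)=\overline{\mathbb{D}}$. (b) If $c\in\mathbb{C}\setminus\overline{\mathbb{D}}$, then $\lim_{t\to\infty}J(F_{t,c})=\lim_{t\to\infty}K(F_{t,c})=S^1$. (c) If $c\in\mathbb{D}$, then $\lim_{t\to\infty}J(F_{t,c})=S^1$ and $\lim_{t\to\infty}K(F_{t,c})=\overline{\mathbb{D}}$. (d) If $c\in S^1$, then if $\lim_{t\to\infty}J(F_{t,c})$ and/or $\lim_{t\to\infty}K(F_{t,c})$ (and/or any liminf or limsup of these families of sets) exists, it is contained in $\overline{\mathbb{D}}$.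
   Context: $\mathbb{D}$ is the open unit disk in $\mathbb{C}$, $\overline{\mathbb{D}}$ its closure, $S^1$ the unit circle. Convention: $0^t=0$; the principal branch has imaginary part in $(-\pi,\pi]$. $F_{t,c}^m$ is the $m$-th iterate. The filled Julia set is $K(F_{t,c})=\overline{\{z : \{F_{t,c}^m(z)\}_{m=1}^\infty\text{ is bounded}\}}$, the Julia set is the topological boundary $J(F_{t,c})=\partial K(F_{t,c})$, and the Mandelbrot set is $M_t(F)=\overline{\{c : \{F_{t,c}^m(0)\}_{m=1}^\infty\text{ is bounded}\}}$. The Hausdorff metric is $d_{\mathcal{H}}(A,B)=\max\{\sup_{a\in A}\inf_{b\in B}d(a,b),\ \sup_{b\in B}\inf_{a\in A}d(a,b)\}$, and $\lim_{t\to\infty}S_t=S$ means that for all $\epsilon>0$ there is $T$ with $d_{\mathcal{H}}(S_t,S)<\epsilon$ for all real $t\ge T$. The limsup (resp. liminf) of a family $S_t$ as $t\to\infty$ is understood as the set of points $z$ such that every neighborhood of $z$ meets $S_t$ for arbitrarily large $t$ (resp. for all sufficiently large $t$). *)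

theory Defs
  imports "HOL-Analysis.Analysis"
begin

(* On type complex, "z powr w" is "exp (w * Ln z)" with Im (Ln z) in (-pi, pi] for z \<noteq> 0,
   and "0 powr w = 0". *)
definition F :: "real \<Rightarrow> complex \<Rightarrow> complex \<Rightarrow> complex" where
  "F t c z = z powr (of_real t) + c"

definition filled_Julia :: "real \<Rightarrow> complex \<Rightarrow> complex set" where
  "filled_Julia t c = closure {z. bounded {(F t c ^^ m) z | m. m \<ge> 1}}"

definition Julia :: "real \<Rightarrow> complex \<Rightarrow> complex set" where
  "Julia t c = frontier (filled_Julia t c)"

definition Mandelbrot :: "real \<Rightarrow> complex set" where
  "Mandelbrot t = closure {c. bounded {(F t c ^^ m) 0 | m. m \<ge> 1}}"

(* The values are in ennreal so that suprema over unbounded sets and infima over the empty set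
   are infinite; on real-valued Sup and Inf they would be unspecified. *)
definition hausdorff_distance :: "'a::metric_space set \<Rightarrow> 'a set \<Rightarrow> ennreal" where
  "hausdorff_distance A B =
     max (SUP a\<in>A. INF b\<in>B. ennreal (dist a b)) (SUP b\<in>B. INF a\<in>A. ennreal (dist a b))"

(* The families of sets below are indexed by the reals t \<ge> 2, hence the bounds T \<ge> 2. *)
definition hausdorff_limit :: "(real \<Rightarrow> 'a::metric_space set) \<Rightarrow> 'a set \<Rightarrow> bool" where
  "hausdorff_limit S L \<longleftrightarrow>
     (\<forall>\<epsilon>>0. \<exists>T\<ge>2. \<forall>t\<ge>T. hausdorff_distance (S t) L < ennreal \<epsilon>)"

definition set_limsup :: "(real \<Rightarrow> 'a::topological_space set) \<Rightarrow> 'a set" where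
  "set_limsup S = {z. \<forall>U. open U \<and> z \<in> U \<longrightarrow> (\<forall>T\<ge>2. \<exists>t\<ge>T. U \<inter> S t \<noteq> {})}"

definition set_liminf :: "(real \<Rightarrow> 'a::topological_space set) \<Rightarrow> 'a set" where
  "set_liminf S = {z. \<forall>U. open U \<and> z \<in> U \<longrightarrow> (\<exists>T\<ge>2. \<forall>t\<ge>T. U \<inter> S t \<noteq> {})}"

end

theory Submission
  imports Defs "HOL-Real_Asymp.Real_Asymp"
begin

text \<open>
  Since the modulus of \<open>z powr t\<close> is \<open>norm z powr t\<close>, for large \<open>t\<close> the power map crushes every
  disk of radius less than \<open>1\<close> to nearly a point and throws everything outside a disk of radius
  larger than \<open>1\<close> far away.  Three consequences give all the upper bounds and the lower bounds
  inside the disk.  Points of modulus at least \<open>R > 1\<close> escape (\<open>unbounded_orbit\<close>), so the filled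
  Julia sets are eventually in \<open>cball 0 R\<close>.  If \<open>norm c < r < 1\<close>, then \<open>cball 0 r\<close> is eventually
  mapped into itself (\<open>bounded_orbit_trap\<close>).  If \<open>norm c > 1\<close>, then a disk of radius \<open>r < 1\<close> is
  mapped close to \<open>c\<close>, from where orbits escape.  The first two facts hold uniformly enough in \<open>c\<close>
  to settle the Mandelbrot set as well, and for \<open>norm c = 1\<close> the first alone gives the claim.

  What remains is that for \<open>norm c > 1\<close> the filled Julia set comes near every point of the unit
  circle.  Here there are even fixed points: in the coordinate \<open>u = Ln z\<close> the equation
  \<open>z powr t + c = z\<close> is solved by the fixed points of
  \<open>u \<mapsto> (Ln (- c) + Ln (1 - exp u / c) + 2 * pi * k * \<i>) / t\<close>.  The division by \<open>t\<close> makes the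
  first two terms negligible, and the free integer \<open>k\<close> places the third within \<open>pi / t\<close> of any
  prescribed point of the imaginary axis, so Brouwer's theorem applies on a small disk around that
  point (\<open>fixed_point_in_log_coordinate\<close>).  The discontinuity of the principal branch
  is avoided by staying slightly away from the negative real axis.

  The Julia set needs no separate dynamics: a small disk around a point of the unit circle meets
  the filled Julia set and also contains points of modulus larger than \<open>1\<close> that lie outside it,
  hence it meets the frontier.
\<close>

section \<open>Hausdorff limits through eventual mutual approximation\<close>

lemma hausdorff_distance_lessD:
  assumes "hausdorff_distance A B < ennreal e"
  shows "\<forall>a\<in>A. \<exists>b\<in>B. dist a b < e" and "\<forall>b\<in>B. \<exists>a\<in>A. dist a b < e"
proof -
  have 1: "(SUP a\<in>A. INF b\<in>B. ennreal (dist a b)) < ennreal e"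
    and 2: "(SUP b\<in>B. INF a\<in>A. ennreal (dist a b)) < ennreal e"
    using assms by (auto simp: hausdorff_distance_def)
  show "\<forall>a\<in>A. \<exists>b\<in>B. dist a b < e"
  proof
    fix a assume "a \<in> A"
    hence "(INF b\<in>B. ennreal (dist a b)) < ennreal e"
      by (rule le_less_trans[OF SUP_upper 1])
    thus "\<exists>b\<in>B. dist a b < e"
      by (auto simp: INF_less_iff ennreal_less_iff)
  qed
  show "\<forall>b\<in>B. \<exists>a\<in>A. dist a b < e"
  proof
    fix b assume "b \<in> B"
    hence "(INF a\<in>A. ennreal (dist a b)) < ennreal e"
      by (rule le_less_trans[OF SUP_upper 2])
    thus "\<exists>a\<in>A. dist a b < e"
      by (auto simp: INF_less_iff ennreal_less_iff)
  qed
qed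

lemma hausdorff_distance_leI:
  assumes "\<forall>a\<in>A. \<exists>b\<in>B. dist a b < e" and "\<forall>b\<in>B. \<exists>a\<in>A. dist a b < e"
  shows "hausdorff_distance A B \<le> ennreal e"
  unfolding hausdorff_distance_def
proof (intro max.boundedI SUP_least)
  fix a assume "a \<in> A"
  then obtain b where "b \<in> B" "dist a b < e" using assms(1) by blast
  thus "(INF b\<in>B. ennreal (dist a b)) \<le> ennreal e"
    by (intro INF_lower2[of b]) (auto intro: ennreal_leI)
next
  fix b assume "b \<in> B"
  then obtain a where "a \<in> A" "dist a b < e" using assms(2) by blast
  thus "(INF a\<in>A. ennreal (dist a b)) \<le> ennreal e"
    by (intro INF_lower2[of a]) (auto intro: ennreal_leI)
qed

lemma eventually_at_top_ge_2_iff: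
  "(\<forall>\<^sub>F t::real in at_top. P t) \<longleftrightarrow> (\<exists>T\<ge>2. \<forall>t\<ge>T. P t)"
proof
  assume "\<forall>\<^sub>F t in at_top. P t"
  then obtain T where "\<forall>t\<ge>T. P t" by (auto simp: eventually_at_top_linorder)
  thus "\<exists>T\<ge>2. \<forall>t\<ge>T. P t" by (intro exI[of _ "max 2 T"]) auto
qed (auto simp: eventually_at_top_linorder)

lemma hausdorff_limit_iff:
  "hausdorff_limit S L \<longleftrightarrow>
     (\<forall>e>0. \<forall>\<^sub>F t in at_top. (\<forall>a\<in>S t. \<exists>b\<in>L. dist a b < e) \<and> (\<forall>b\<in>L. \<exists>a\<in>S t. dist a b < e))"
  (is "_ \<longleftrightarrow> (\<forall>e>0. \<forall>\<^sub>F t in at_top. ?P e t)")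
proof -
  have "hausdorff_limit S L \<longleftrightarrow>
      (\<forall>e>0. \<forall>\<^sub>F t in at_top. hausdorff_distance (S t) L < ennreal e)"
    by (simp add: hausdorff_limit_def eventually_at_top_ge_2_iff)
  also have "\<dots> \<longleftrightarrow> (\<forall>e>0. \<forall>\<^sub>F t in at_top. ?P e t)"
  proof (intro iffI allI impI)
    fix e :: real
    assume "\<forall>e>0. \<forall>\<^sub>F t in at_top. hausdorff_distance (S t) L < ennreal e" and "e > 0"
    hence "\<forall>\<^sub>F t in at_top. hausdorff_distance (S t) L < ennreal e" by blast
    thus "\<forall>\<^sub>F t in at_top. ?P e t"
      by eventually_elim (blast dest: hausdorff_distance_lessD)
  next
    fix e :: real
    assume *: "\<forall>e>0. \<forall>\<^sub>F t in at_top. ?P e t" and e: "e > 0"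
    have "\<forall>\<^sub>F t in at_top. ?P (e/2) t" using *[rule_format, of "e/2"] e by simp
    thus "\<forall>\<^sub>F t in at_top. hausdorff_distance (S t) L < ennreal e"
    proof eventually_elim
      case (elim t)
      hence "hausdorff_distance (S t) L \<le> ennreal (e/2)"
        by (intro hausdorff_distance_leI) auto
      also have "\<dots> < ennreal e" using e by (simp add: ennreal_less_iff)
      finally show ?case .
    qed
  qed
  finally show ?thesis .
qed

text \<open>
  A point of the limit has points of \<open>S t\<close> arbitrarily close to it; such points exist because the
  empty set is at infinite distance from every nonempty set.
\<close>

lemma hausdorff_limit_subset_cball:
  fixes S :: "real \<Rightarrow> complex set"
  assumes lim: "hausdorff_limit S L"
    and S: "\<And>R. R > 1 \<Longrightarrow> \<forall>\<^sub>F t in at_top. S t \<subseteq> cball 0 R"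
  shows "L \<subseteq> cball 0 1"
proof
  fix x assume x: "x \<in> L"
  have "norm x \<le> 1 + e" if e: "e > 0" for e
  proof -
    have "\<forall>\<^sub>F t in at_top. (\<forall>b\<in>L. \<exists>a\<in>S t. dist a b < e/2)"
      using lim e unfolding hausdorff_limit_iff
      by (auto dest!: spec[of _ "e/2"] elim: eventually_mono)
    moreover have "\<forall>\<^sub>F t in at_top. S t \<subseteq> cball 0 (1 + e/2)" using S e by simp
    ultimately have "\<forall>\<^sub>F t::real in at_top. norm x \<le> 1 + e"
    proof eventually_elim
      case (elim t)
      then obtain a where "a \<in> S t" "dist a x < e/2" using x by blast
      moreover from this elim have "norm a \<le> 1 + e/2" by auto
      moreover have "norm x \<le> norm a + dist a x"
        by (metis dist_norm norm_minus_commute norm_triangle_sub)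
      ultimately show ?case by linarith
    qed
    thus ?thesis by simp
  qed
  thus "x \<in> cball 0 1" by (simp add: field_le_epsilon)
qed

lemma set_limsup_subset_cball:
  fixes S :: "real \<Rightarrow> complex set"
  assumes S: "\<And>R. R > 1 \<Longrightarrow> \<forall>\<^sub>F t in at_top. S t \<subseteq> cball 0 R"
  shows "set_limsup S \<subseteq> cball 0 1"
proof
  fix x assume x: "x \<in> set_limsup S"
  show "x \<in> cball 0 1"
  proof (rule ccontr)
    assume "x \<notin> cball 0 1"
    then obtain R where R: "1 < R" "R < norm x" using dense[of 1 "norm x"] by auto
    then obtain T where T: "T \<ge> 2" "\<forall>t\<ge>T. S t \<subseteq> cball 0 R"
      using S eventually_at_top_ge_2_iff by metis
    have "open (- cball 0 R)" "x \<in> - cball 0 R" using R by auto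
    then obtain t where "t \<ge> T" "(- cball 0 R) \<inter> S t \<noteq> {}"
      using x T(1) unfolding set_limsup_def by blast
    thus False using T(2) by blast
  qed
qed

lemma set_liminf_subset_set_limsup: "set_liminf S \<subseteq> set_limsup S"
proof
  fix x assume x: "x \<in> set_liminf S"
  have "\<exists>t\<ge>T. U \<inter> S t \<noteq> {}" if U: "open U" "x \<in> U" for U and T :: real
  proof -
    obtain T' where "\<forall>t\<ge>T'. U \<inter> S t \<noteq> {}"
      using x U unfolding set_liminf_def by blast
    thus ?thesis by (intro exI[of _ "max T T'"]) auto
  qed
  thus "x \<in> set_limsup S" unfolding set_limsup_def by blast
qed

section \<open>Disks, circles and frontiers\<close>

lemma ex_sphere_dist_eq:
  fixes z :: complex
  shows "\<exists>b\<in>sphere 0 1. dist z b = \<bar>norm z - 1\<bar>"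
proof (cases "z = 0")
  case True
  thus ?thesis by (intro bexI[of _ 1]) auto
next
  case False
  have "z - sgn z = (norm z - 1) *\<^sub>R sgn z"
    using False by (simp add: sgn_div_norm algebra_simps)
  hence "dist z (sgn z) = \<bar>norm z - 1\<bar>"
    using False by (simp add: dist_norm norm_sgn)
  moreover have "sgn z \<in> sphere 0 1" using False by (simp add: norm_sgn)
  ultimately show ?thesis by blast
qed

lemma sphere_close_if_annulus:
  fixes z :: complex
  assumes "1 - e < norm z" "norm z < 1 + e"
  shows "\<exists>b\<in>sphere 0 1. dist z b < e"
  using ex_sphere_dist_eq[of z] assms by (metis abs_diff_less_iff)

lemma cball_close_if_norm_less:
  fixes z :: complex
  assumes "norm z < 1 + e" "e > 0"
  shows "\<exists>b\<in>cball 0 1. dist z b < e"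
proof (cases "norm z \<le> 1")
  case True
  thus ?thesis using assms by (intro bexI[of _ z]) auto
next
  case False
  then obtain b where "b \<in> sphere 0 1" "dist z b < e"
    using sphere_close_if_annulus[of e z] assms by auto
  thus ?thesis by (intro bexI[of _ b]) auto
qed

lemma smaller_cball_close_to_cball:
  fixes b :: complex
  assumes b: "b \<in> cball 0 1" and r: "0 < r" "r < 1" "1 - e < r"
  shows "\<exists>a\<in>cball 0 r. dist a b < e"
proof (intro bexI)
  have "of_real r * b - b = of_real (r - 1) * b" by (simp add: algebra_simps)
  hence "dist (of_real r * b) b = \<bar>r - 1\<bar> * norm b"
    by (simp only: dist_norm norm_mult norm_of_real)
  also have "\<dots> = (1 - r) * norm b" using r by simp
  also have "\<dots> \<le> (1 - r) * 1" using b r by (intro mult_left_mono) auto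
  finally show "dist (of_real r * b) b < e" using r by simp
  have "r * norm b \<le> r * 1" using b r by (intro mult_left_mono) auto
  thus "of_real r * b \<in> cball 0 r" using r by (simp add: norm_mult)
qed

text \<open>
  The point \<open>(1 + e/2) * w\<close> of the disk around \<open>w\<close> is outside \<open>K\<close>; a connected set that
  meets both \<open>K\<close> and its complement meets the frontier.
\<close>

lemma frontier_close_to_sphere_point:
  fixes w :: complex
  assumes w: "norm w = 1" and e: "e > 0" and K: "K \<subseteq> cball 0 (1 + e/3)"
    and a: "a \<in> K" "dist a w < e"
  shows "\<exists>a\<in>frontier K. dist a w < e"
proof -
  define p where "p = of_real (1 + e/2) * w"
  have "norm p = 1 + e/2" using w e unfolding p_def norm_mult norm_of_real by simp
  hence "p \<notin> K" using K e by (auto simp: subset_iff)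
  moreover have "dist p w = e/2"
  proof -
    have "p - w = of_real (e/2) * w" by (simp add: p_def algebra_simps)
    thus ?thesis using w e by (simp only: dist_norm norm_mult norm_of_real)
  qed
  ultimately have "p \<in> ball w e - K" using e by (simp add: dist_commute)
  hence "ball w e - K \<noteq> {}" by blast
  moreover have "a \<in> ball w e \<inter> K" using a by (simp add: dist_commute)
  hence "ball w e \<inter> K \<noteq> {}" by blast
  ultimately have "ball w e \<inter> frontier K \<noteq> {}"
    by (intro connected_Int_frontier) auto
  thus ?thesis by (auto simp: dist_commute)
qed

section \<open>Escaping and trapped orbits\<close>

definition bounded_orbit :: "real \<Rightarrow> complex \<Rightarrow> complex \<Rightarrow> bool" where
  "bounded_orbit t c z \<longleftrightarrow> bounded {(F t c ^^ m) z | m. m \<ge> 1}"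

lemma filled_Julia_eq: "filled_Julia t c = closure {z. bounded_orbit t c z}"
  by (simp add: filled_Julia_def bounded_orbit_def)

lemma Mandelbrot_eq: "Mandelbrot t = closure {c. bounded_orbit t c 0}"
  by (simp add: Mandelbrot_def bounded_orbit_def)

lemma bounded_orbit_step:
  assumes "bounded_orbit t c z"
  shows "bounded_orbit t c (F t c z)"
proof -
  obtain B where B: "\<And>m. m \<ge> 1 \<Longrightarrow> norm ((F t c ^^ m) z) \<le> B"
    using assms unfolding bounded_orbit_def bounded_iff by blast
  have "norm ((F t c ^^ m) (F t c z)) \<le> B" for m
    using B[of "Suc m"] by (simp add: funpow_swap1)
  thus ?thesis unfolding bounded_orbit_def bounded_iff by blast
qed

lemma norm_powr_of_real: "norm (z powr of_real t) = norm z powr t" for z :: complex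
  by (cases "z = 0") (auto simp: norm_powr_real_powr')

lemma norm_F_le: "norm (F t c z) \<le> norm z powr t + norm c"
  unfolding F_def by (metis norm_powr_of_real norm_triangle_ineq)

lemma norm_F_ge: "norm z powr t - norm c \<le> norm (F t c z)"
  unfolding F_def by (metis norm_powr_of_real norm_diff_ineq)

text \<open>
  Writing the modulus of \<open>z powr t\<close> as \<open>norm z * norm z powr (t - 1)\<close> shows that each step at
  least doubles the modulus.  The quotient \<open>norm c / r\<close>, instead of \<open>norm c\<close>, makes the condition
  uniform in \<open>c\<close> when \<open>r = norm c\<close>, as the Mandelbrot set requires.
\<close>

lemma norm_F_doubles:
  assumes r: "0 < r" "r \<le> norm z" and t: "t \<ge> 1" and big: "2 + norm c / r \<le> r powr (t - 1)"
  shows "2 * norm z \<le> norm (F t c z)"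
proof -
  have "r powr (t - 1) \<le> norm z powr (t - 1)" using r t by (intro powr_mono2) auto
  hence "2 + norm c / r \<le> norm z powr (t - 1)" using big by linarith
  hence "norm z * (2 + norm c / r) \<le> norm z * norm z powr (t - 1)"
    by (rule mult_left_mono) auto
  also have "\<dots> = norm z powr t" using r by (simp add: powr_mult_base)
  finally have "2 * norm z + norm z / r * norm c \<le> norm z powr t"
    by (simp add: algebra_simps)
  moreover have "1 * norm c \<le> norm z / r * norm c"
    using r by (intro mult_right_mono) auto
  ultimately show ?thesis using norm_F_ge[of z t c] by linarith
qed

lemma unbounded_orbit:
  assumes r: "0 < r" "r \<le> norm z" and t: "t \<ge> 1" and big: "2 + norm c / r \<le> r powr (t - 1)"
  shows "\<not> bounded_orbit t c z"
proof
  have growth: "2 ^ m * r \<le> norm ((F t c ^^ m) z)" for m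
  proof (induction m)
    case (Suc m)
    have "1 * r \<le> 2 ^ m * r" using r by (intro mult_right_mono) auto
    hence "r \<le> norm ((F t c ^^ m) z)" using Suc by linarith
    hence "2 * norm ((F t c ^^ m) z) \<le> norm (F t c ((F t c ^^ m) z))"
      using r t big by (intro norm_F_doubles[of r]) auto
    thus ?case using Suc by simp
  qed (use r in simp)
  assume "bounded_orbit t c z"
  then obtain B where B: "\<And>m. m \<ge> 1 \<Longrightarrow> norm ((F t c ^^ m) z) \<le> B"
    unfolding bounded_orbit_def bounded_iff by blast
  obtain m :: nat where "B / r < 2 ^ m" using real_arch_pow[of 2 "B / r"] by auto
  hence "B < 2 ^ m * r" using r by (simp add: field_simps)
  also have "\<dots> \<le> 2 ^ Suc m * r" using r by simp
  also have "\<dots> \<le> norm ((F t c ^^ Suc m) z)" by (rule growth)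
  also have "\<dots> \<le> B" by (rule B) simp
  finally show False by simp
qed

lemma bounded_orbit_trap:
  assumes z: "norm z \<le> r" and t: "t \<ge> 0" and trap: "r powr t + norm c \<le> r"
  shows "bounded_orbit t c z"
proof -
  have "norm ((F t c ^^ m) z) \<le> r" for m
  proof (induction m)
    case (Suc m)
    have "norm ((F t c ^^ m) z) powr t \<le> r powr t" using Suc t by (intro powr_mono2) auto
    thus ?case using norm_F_le[of t c "(F t c ^^ m) z"] trap by simp
  qed (use z in simp)
  thus ?thesis unfolding bounded_orbit_def bounded_iff by blast
qed

lemma bounded_orbit_fixed_point:
  assumes "F t c z = z"
  shows "bounded_orbit t c z"
proof -
  have "(F t c ^^ m) z = z" for m using assms by (induction m) auto
  thus ?thesis by (auto simp: bounded_orbit_def bounded_iff)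
qed

lemma eventually_powr_large:
  fixes r :: real
  assumes "r > 1"
  shows "\<forall>\<^sub>F t in at_top. B \<le> r powr (t - 1)"
proof -
  have "filterlim (\<lambda>t. r powr (t - 1)) at_top at_top" using assms by real_asymp
  thus ?thesis by (simp add: filterlim_at_top)
qed

lemma eventually_powr_small:
  fixes r :: real
  assumes "0 < r" "r < 1" "e > 0"
  shows "\<forall>\<^sub>F t in at_top. r powr t < e"
proof -
  have "((\<lambda>t. r powr t) \<longlongrightarrow> 0) at_top" using assms by real_asymp
  thus ?thesis using assms by (simp add: order_tendsto_iff)
qed

section \<open>Bounds for the filled Julia sets\<close>

lemma filled_Julia_subset_cball:
  assumes R: "R > 1"
  shows "\<forall>\<^sub>F t in at_top. filled_Julia t c \<subseteq> cball 0 R"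
  using eventually_powr_large[OF R, of "2 + norm c / R"] eventually_ge_at_top[of 1]
proof eventually_elim
  case (elim t)
  have "{z. bounded_orbit t c z} \<subseteq> cball 0 R"
    using unbounded_orbit[of R _ t c] elim R by force
  thus ?case unfolding filled_Julia_eq by (intro closure_minimal) auto
qed

lemma Julia_subset_filled_Julia: "Julia t c \<subseteq> filled_Julia t c"
  by (simp add: Julia_def filled_Julia_def frontier_subset_closed)

lemma Julia_subset_cball:
  assumes "R > 1"
  shows "\<forall>\<^sub>F t in at_top. Julia t c \<subseteq> cball 0 R"
  using filled_Julia_subset_cball[OF assms, of c] Julia_subset_filled_Julia
  by (auto elim!: eventually_mono)

lemma cball_subset_filled_Julia:
  assumes r: "0 < r" "r < 1" "norm c < r"
  shows "\<forall>\<^sub>F t in at_top. cball 0 r \<subseteq> filled_Julia t c"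
proof -
  have "\<forall>\<^sub>F t in at_top. r powr t < r - norm c" using eventually_powr_small r by simp
  moreover note eventually_ge_at_top[of 0]
  ultimately show ?thesis
  proof eventually_elim
    case (elim t)
    have "cball 0 r \<subseteq> {z. bounded_orbit t c z}"
      using bounded_orbit_trap[of _ r t c] elim by auto
    thus ?case unfolding filled_Julia_eq using closure_subset by blast
  qed
qed

text \<open>
  One step moves the disk \<open>ball 0 r\<close> into the disk of radius \<open>r powr t\<close> around \<open>c\<close>, hence
  outside the disk of some fixed radius \<open>R\<close> with \<open>1 < R < norm c\<close>.
\<close>

lemma filled_Julia_avoids_ball:
  assumes c: "norm c > 1" and r: "0 < r" "r < 1"
  shows "\<forall>\<^sub>F t in at_top. filled_Julia t c \<inter> ball 0 r = {}"
proof -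
  obtain R where R: "1 < R" "R < norm c" using c dense by blast
  have "\<forall>\<^sub>F t in at_top. r powr t < norm c - R" using eventually_powr_small r R by simp
  moreover note eventually_powr_large[OF R(1), of "2 + norm c / R"] eventually_ge_at_top[of 1]
  ultimately show ?thesis
  proof eventually_elim
    case (elim t)
    have "\<not> bounded_orbit t c z" if z: "z \<in> ball 0 r" for z
    proof -
      have "norm z powr t \<le> r powr t" using z elim by (intro powr_mono2) auto
      moreover have "norm c - norm z powr t \<le> norm (F t c z)"
        unfolding F_def by (metis add.commute norm_powr_of_real norm_diff_ineq)
      ultimately have "R \<le> norm (F t c z)" using elim by linarith
      hence "\<not> bounded_orbit t c (F t c z)"
        using elim R by (intro unbounded_orbit[of R]) auto
      thus ?thesis using bounded_orbit_step by blast
    qed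
    hence "{z. bounded_orbit t c z} \<inter> ball 0 r = {}" by blast
    thus ?case unfolding filled_Julia_eq
      by (metis Int_commute open_Int_closure_eq_empty open_ball)
  qed
qed

section \<open>Fixed points near the unit circle\<close>

text \<open>
  For \<open>z = exp u\<close> one has \<open>z - c = - c * (1 - z / c)\<close>, and \<open>1 - z / c\<close> lies in the right half
  plane as long as \<open>norm z < norm c\<close>.  So the map \<open>h\<close> below is a continuous inverse branch of
  \<open>z \<mapsto> z powr t + c\<close>, written in the coordinate \<open>u\<close>.
\<close>

lemma fixed_point_in_log_coordinate:
  assumes d: "d > 0" "exp d < norm c" and \<theta>: "\<bar>\<theta>\<bar> + d < pi"
    and M: "\<And>z. z \<in> cball 0 (exp d) \<Longrightarrow> norm (Ln (1 - z / c)) \<le> M"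
    and t: "t > 0" "(norm (Ln (- c)) + M + pi) / t \<le> d"
  shows "\<exists>u\<in>cball (\<i> * of_real \<theta>) d. F t c (exp u) = exp u"
proof -
  \<comment> \<open>The term \<open>2 * pi * k * \<i> / t\<close> of \<open>h\<close> should be as close as possible to \<open>\<i> * \<theta>\<close>.\<close>
  define k where "k = round (t * \<theta> / (2 * pi))"
  define h where "h = (\<lambda>u. (Ln (- c) + Ln (1 - exp u / c) + of_real (2 * pi * of_int k) * \<i>) / of_real t)"
  let ?S = "cball (\<i> * of_real \<theta>) d"
  have c0: "c \<noteq> 0" using d by (metis exp_gt_zero norm_zero not_less_iff_gr_or_eq order_less_trans)
  have k: "\<bar>2 * pi * of_int k - t * \<theta>\<bar> \<le> pi"
  proof -
    have "\<bar>of_int k - t * \<theta> / (2 * pi)\<bar> \<le> 1 / 2"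
      unfolding k_def by (rule of_int_round_abs_le)
    hence "2 * pi * \<bar>of_int k - t * \<theta> / (2 * pi)\<bar> \<le> 2 * pi * (1 / 2)"
      by (intro mult_left_mono) auto
    moreover have "2 * pi * \<bar>of_int k - t * \<theta> / (2 * pi)\<bar> = \<bar>2 * pi * (of_int k - t * \<theta> / (2 * pi))\<bar>"
      by (simp add: abs_mult)
    moreover have "2 * pi * (of_int k - t * \<theta> / (2 * pi)) = 2 * pi * of_int k - t * \<theta>"
      by (simp add: field_simps)
    ultimately show ?thesis by simp
  qed
  have exp_S: "norm (exp u) \<le> exp d" if "u \<in> ?S" for u
  proof -
    have "\<bar>Re (u - \<i> * of_real \<theta>)\<bar> \<le> d"
      using that abs_Re_le_cmod[of "u - \<i> * of_real \<theta>"] by (simp add: dist_norm norm_minus_commute)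
    thus ?thesis by (simp add: norm_exp_eq_Re)
  qed
  have half_plane: "0 < Re (1 - exp u / c)" if "u \<in> ?S" for u
  proof -
    have "norm (exp u / c) < 1" using order_le_less_trans[OF exp_S[OF that] d(2)] c0
      by (simp add: norm_divide del: norm_exp_eq_Re)
    thus ?thesis using complex_Re_le_cmod[of "exp u / c"] by simp
  qed
  have cont: "continuous_on ?S h"
    unfolding h_def
  proof (intro continuous_intros)
    show "1 - exp u / c \<notin> \<real>\<^sub>\<le>\<^sub>0" if "u \<in> ?S" for u
      using half_plane[OF that] unfolding complex_nonpos_Reals_iff by linarith
  qed (use t c0 in auto)
  have h_S: "h ` ?S \<subseteq> ?S"
  proof
    fix v assume "v \<in> h ` ?S"
    then obtain u where u: "u \<in> ?S" "v = h u" by blast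
    have "v - \<i> * of_real \<theta> =
        (Ln (- c) + Ln (1 - exp u / c) + of_real (2 * pi * of_int k - t * \<theta>) * \<i>) / of_real t"
      using t unfolding u(2) h_def by (simp add: field_simps)
    also have "norm \<dots> = norm (Ln (- c) + Ln (1 - exp u / c) + of_real (2 * pi * of_int k - t * \<theta>) * \<i>) / t"
      using t by (simp add: norm_divide)
    also have "\<dots> \<le> (norm (Ln (- c)) + M + pi) / t"
    proof (intro divide_right_mono norm_triangle_mono)
      show "norm (Ln (1 - exp u / c)) \<le> M" using exp_S[OF u(1)] by (intro M) simp
      show "norm (of_real (2 * pi * of_int k - t * \<theta>) * \<i>) \<le> pi"
        using k by (simp only: norm_mult norm_of_real norm_ii mult_1_right)
    qed (use t in auto)
    finally show "v \<in> ?S" using t by (simp add: dist_norm norm_minus_commute)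
  qed
  obtain u where u: "u \<in> ?S" "h u = u"
    using brouwer[OF compact_cball convex_cball _ cont] h_S d by auto
  have "\<bar>Im (u - \<i> * of_real \<theta>)\<bar> \<le> d"
    using u(1) abs_Im_le_cmod[of "u - \<i> * of_real \<theta>"] by (simp add: dist_norm norm_minus_commute)
  hence Im_u: "- pi < Im u" "Im u \<le> pi" using \<theta> by auto
  have "of_real t * u = Ln (- c) + Ln (1 - exp u / c) + of_real (2 * pi * of_int k) * \<i>"
    using t u(2) unfolding h_def by (simp add: field_simps)
  hence "exp (of_real t * u) = exp (Ln (- c)) * exp (Ln (1 - exp u / c))"
    by (simp add: exp_add exp_eq_1 mult.commute)
  also have "\<dots> = - c * (1 - exp u / c)"
    using c0 half_plane[OF u(1)] by (subst (1 2) exp_Ln) auto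
  also have "\<dots> = exp u - c" using c0 by (simp add: field_simps)
  finally have "F t c (exp u) = exp u"
    unfolding F_def powr_def using Im_u by (simp add: Ln_exp)
  with u(1) show ?thesis by blast
qed

text \<open>
  The threshold for \<open>t\<close> is uniform over the circle because the bound \<open>M\<close> on the logarithmic term
  depends only on \<open>c\<close> and \<open>d\<close>.
\<close>

lemma fixed_points_close_to_sphere:
  assumes c: "norm c > 1" and e: "e > 0"
  shows "\<forall>\<^sub>F t in at_top. \<forall>w\<in>sphere 0 1. \<exists>z. F t c z = z \<and> dist z w < e"
proof -
  have "uniformly_continuous_on (cball 0 6) (exp :: complex \<Rightarrow> complex)"
    by (intro compact_uniformly_continuous continuous_intros) auto
  then obtain d0 where d0: "d0 > 0"
    and unif: "\<And>u v :: complex. u \<in> cball 0 6 \<Longrightarrow> v \<in> cball 0 6 \<Longrightarrow> dist u v < d0 \<Longrightarrow> dist (exp u) (exp v) < e"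
    using e unfolding uniformly_continuous_on_def by metis
  \<comment> \<open>The fixed point found below satisfies \<open>dist u (\<i> * \<phi>) \<le> 3 * d\<close>, where \<open>\<i> * \<phi>\<close> is the
      logarithm of the given point of the circle: \<open>2 * d\<close> for avoiding the branch cut and \<open>d\<close> for
      the radius of the disk.\<close>
  define d where "d = Min {1/2, d0/4, ln (norm c) / 2}"
  have d: "d > 0" "d \<le> 1/2" "3 * d < d0" "d < ln (norm c)"
    using ln_gt_zero[OF c] d0 unfolding d_def by (auto simp: min_def)
  have exp_d: "exp d < norm c" using d(4) c by (metis exp_less_cancel_iff exp_ln less_trans zero_less_one)
  have "continuous_on (cball 0 (exp d)) (\<lambda>z. Ln (1 - z / c))"
  proof (intro continuous_intros)
    show "1 - z / c \<notin> \<real>\<^sub>\<le>\<^sub>0" if "z \<in> cball 0 (exp d)" for z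
    proof -
      have "norm z < norm c" using that exp_d by simp
      moreover have "norm c > 0" using c by linarith
      ultimately have "norm (z / c) < 1" by (simp add: norm_divide)
      hence "0 < Re (1 - z / c)" using complex_Re_le_cmod[of "z / c"] by simp
      thus ?thesis unfolding complex_nonpos_Reals_iff by linarith
    qed
  qed (use c in auto)
  hence "bounded ((\<lambda>z. Ln (1 - z / c)) ` cball 0 (exp d))"
    by (intro compact_imp_bounded compact_continuous_image) auto
  then obtain M where M: "\<And>z. z \<in> cball 0 (exp d) \<Longrightarrow> norm (Ln (1 - z / c)) \<le> M"
    unfolding bounded_iff by blast
  have "\<forall>\<^sub>F t in at_top. (norm (Ln (- c)) + M + pi) / d \<le> t" by (rule eventually_ge_at_top)
  moreover have "\<forall>\<^sub>F t::real in at_top. t > 0" by (rule eventually_gt_at_top)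
  ultimately show ?thesis
  proof eventually_elim
    case (elim t)
    hence t: "t > 0" "(norm (Ln (- c)) + M + pi) / t \<le> d" using d by (auto simp: field_simps)
    show ?case
    proof
      fix w :: complex assume w: "w \<in> sphere 0 1"
      define \<phi> where "\<phi> = Im (Ln w)"
      have w_exp: "w = exp (\<i> * of_real \<phi>)"
      proof -
        have "w \<noteq> 0" using w by auto
        moreover have "Ln w = \<i> * of_real \<phi>"
          using w \<open>w \<noteq> 0\<close> by (intro complex_eqI) (auto simp: \<phi>_def)
        ultimately show ?thesis by (metis exp_Ln)
      qed
      have \<phi>: "\<bar>\<phi>\<bar> \<le> pi"
        using w mpi_less_Im_Ln[of w] Im_Ln_le_pi[of w] unfolding \<phi>_def by force
      \<comment> \<open>The angle is moved so far from the branch cut that the disk of radius \<open>d\<close> around it stays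
          in the strip where \<open>Ln\<close> inverts \<open>exp\<close>.\<close>
      define \<theta> where "\<theta> = max (- (pi - 2 * d)) (min (pi - 2 * d) \<phi>)"
      have \<theta>: "\<bar>\<theta>\<bar> + d < pi" "\<bar>\<theta> - \<phi>\<bar> \<le> 2 * d"
        using d \<phi> pi_gt3 unfolding \<theta>_def by (auto simp: max_def min_def abs_if)
      obtain u where u: "u \<in> cball (\<i> * of_real \<theta>) d" "F t c (exp u) = exp u"
        using fixed_point_in_log_coordinate[OF d(1) exp_d \<theta>(1) M t] by blast
      have "dist (\<i> * of_real \<theta>) (\<i> * of_real \<phi>) = \<bar>\<theta> - \<phi>\<bar>"
        by (simp add: dist_norm norm_mult flip: right_diff_distrib of_real_diff)
      hence "dist u (\<i> * of_real \<phi>) \<le> 3 * d"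
        using u(1) \<theta>(2) dist_triangle[of u "\<i> * of_real \<phi>" "\<i> * of_real \<theta>"]
        by (simp add: dist_commute)
      moreover have "norm (\<i> * of_real \<phi>) \<le> 4" using \<phi> pi_less_4 by (simp add: norm_mult)
      moreover have "norm u \<le> norm (\<i> * of_real \<phi>) + dist u (\<i> * of_real \<phi>)"
        unfolding dist_norm by (metis norm_triangle_sub)
      ultimately have "dist (exp u) w < e"
        unfolding w_exp using d by (intro unif) auto
      with u(2) show "\<exists>z. F t c z = z \<and> dist z w < e" by blast
    qed
  qed
qed

section \<open>The limits\<close>

lemma Mandelbrot_subset_cball:
  assumes R: "R > 1"
  shows "\<forall>\<^sub>F t in at_top. Mandelbrot t \<subseteq> cball 0 R"
  using eventually_powr_large[OF R, of 3] eventually_ge_at_top[of 1]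
proof eventually_elim
  case (elim t)
  have "\<not> bounded_orbit t c 0" if c: "R < norm c" for c
  proof -
    have "R powr (t - 1) \<le> norm c powr (t - 1)" using c R elim by (intro powr_mono2) auto
    moreover have "norm c / norm c = 1" using c R by (intro divide_self) linarith
    ultimately have "2 + norm c / norm c \<le> norm c powr (t - 1)" using elim by linarith
    hence "\<not> bounded_orbit t c c" using c R elim by (intro unbounded_orbit[of "norm c"]) auto
    moreover have "F t c 0 = c" by (simp add: F_def)
    ultimately show ?thesis using bounded_orbit_step by metis
  qed
  hence "{c. bounded_orbit t c 0} \<subseteq> cball 0 R" by force
  thus ?case unfolding Mandelbrot_eq by (intro closure_minimal) auto
qed

text \<open>
  A disk of radius \<open>s\<close> strictly between \<open>r\<close> and \<open>1\<close> is a trap for all parameters \<open>c\<close> in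
  \<open>cball 0 r\<close> simultaneously.
\<close>

lemma cball_subset_Mandelbrot:
  assumes r: "0 < r" "r < 1"
  shows "\<forall>\<^sub>F t in at_top. cball 0 r \<subseteq> Mandelbrot t"
proof -
  obtain s where s: "r < s" "s < 1" using r dense by blast
  have "\<forall>\<^sub>F t in at_top. s powr t < s - r" using eventually_powr_small r s by simp
  moreover note eventually_ge_at_top[of 0]
  ultimately show ?thesis
  proof eventually_elim
    case (elim t)
    have "cball 0 r \<subseteq> {c. bounded_orbit t c 0}"
      using bounded_orbit_trap[of 0 s t] elim r s by auto
    thus ?case unfolding Mandelbrot_eq using closure_subset by blast
  qed
qed

lemma hausdorff_limit_cballI:
  fixes S :: "real \<Rightarrow> complex set"
  assumes outer: "\<And>R. R > 1 \<Longrightarrow> \<forall>\<^sub>F t in at_top. S t \<subseteq> cball 0 R"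
    and s: "s < 1" and inner: "\<And>r. 0 < r \<Longrightarrow> s < r \<Longrightarrow> r < 1 \<Longrightarrow> \<forall>\<^sub>F t in at_top. cball 0 r \<subseteq> S t"
  shows "hausdorff_limit S (cball 0 1)"
  unfolding hausdorff_limit_iff
proof (intro allI impI)
  fix e :: real assume e: "e > 0"
  obtain r where "max (max 0 s) (1 - e) < r" "r < 1"
    using dense[of "max (max 0 s) (1 - e)" 1] s e by auto
  hence r: "0 < r" "s < r" "1 - e < r" "r < 1" by auto
  have "\<forall>\<^sub>F t in at_top. S t \<subseteq> cball 0 (1 + e/2)" using outer e by simp
  moreover have "\<forall>\<^sub>F t in at_top. cball 0 r \<subseteq> S t" using inner r by simp
  ultimately show "\<forall>\<^sub>F t in at_top. (\<forall>a\<in>S t. \<exists>b\<in>cball 0 1. dist a b < e) \<and>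
                               (\<forall>b\<in>cball 0 1. \<exists>a\<in>S t. dist a b < e)"
  proof eventually_elim
    case (elim t)
    have "\<exists>b\<in>cball 0 1. dist a b < e" if "a \<in> S t" for a
    proof -
      have "norm a \<le> 1 + e/2" using that elim by auto
      thus ?thesis using e by (intro cball_close_if_norm_less) auto
    qed
    moreover have "\<exists>a\<in>S t. dist a b < e" if "b \<in> cball 0 1" for b
      using smaller_cball_close_to_cball[OF that r(1) r(4) r(3)] elim by blast
    ultimately show ?case by blast
  qed
qed

lemma hausdorff_limit_sphereI:
  fixes S :: "real \<Rightarrow> complex set"
  assumes outer: "\<And>R. R > 1 \<Longrightarrow> \<forall>\<^sub>F t in at_top. S t \<subseteq> cball 0 R"
    and s: "s < 1" and inner: "\<And>r. 0 < r \<Longrightarrow> s < r \<Longrightarrow> r < 1 \<Longrightarrow> \<forall>\<^sub>F t in at_top. S t \<inter> ball 0 r = {}"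
    and dense: "\<And>e. e > 0 \<Longrightarrow> \<forall>\<^sub>F t in at_top. \<forall>w\<in>sphere 0 1. \<exists>a\<in>S t. dist a w < e"
  shows "hausdorff_limit S (sphere 0 1)"
  unfolding hausdorff_limit_iff
proof (intro allI impI)
  fix e :: real assume e: "e > 0"
  obtain r where "max (max 0 s) (1 - e) < r" "r < 1"
    using Orderings.dense[of "max (max 0 s) (1 - e)" 1] s e by auto
  hence r: "0 < r" "s < r" "1 - e < r" "r < 1" by auto
  have "\<forall>\<^sub>F t in at_top. S t \<subseteq> cball 0 (1 + e/2)" using outer e by simp
  moreover have "\<forall>\<^sub>F t in at_top. S t \<inter> ball 0 r = {}" using inner r by simp
  moreover note dense[OF e]
  ultimately show "\<forall>\<^sub>F t in at_top. (\<forall>a\<in>S t. \<exists>b\<in>sphere 0 1. dist a b < e) \<and>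
                               (\<forall>b\<in>sphere 0 1. \<exists>a\<in>S t. dist a b < e)"
  proof eventually_elim
    case (elim t)
    have "\<exists>b\<in>sphere 0 1. dist a b < e" if "a \<in> S t" for a
    proof -
      have "norm a \<le> 1 + e/2" "r \<le> norm a" using that elim by force+
      thus ?thesis using e r by (intro sphere_close_if_annulus) auto
    qed
    thus ?case using elim by blast
  qed
qed

lemma Julia_close_to_sphere:
  assumes K: "\<And>e. e > 0 \<Longrightarrow> \<forall>\<^sub>F t in at_top. \<forall>w\<in>sphere 0 1. \<exists>a\<in>filled_Julia t c. dist a w < e"
    and e: "e > 0"
  shows "\<forall>\<^sub>F t in at_top. \<forall>w\<in>sphere 0 1. \<exists>a\<in>Julia t c. dist a w < e"
proof -
  have "\<forall>\<^sub>F t in at_top. filled_Julia t c \<subseteq> cball 0 (1 + e/3)"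
    using e by (intro filled_Julia_subset_cball) simp
  with K[OF e] show ?thesis
  proof eventually_elim
    case (elim t)
    thus ?case unfolding Julia_def using frontier_close_to_sphere_point[OF _ e]
      by (metis mem_sphere_0)
  qed
qed

lemma hausdorff_limit_Mandelbrot: "hausdorff_limit Mandelbrot (cball 0 1)"
  by (rule hausdorff_limit_cballI[where s = 0])
     (use Mandelbrot_subset_cball cball_subset_Mandelbrot in auto)

lemma hausdorff_limits_outside:
  assumes c: "norm c > 1"
  shows "hausdorff_limit (\<lambda>t. Julia t c) (sphere 0 1)"
    and "hausdorff_limit (\<lambda>t. filled_Julia t c) (sphere 0 1)"
proof -
  have K: "\<forall>\<^sub>F t in at_top. \<forall>w\<in>sphere 0 1. \<exists>a\<in>filled_Julia t c. dist a w < e" if "e > 0" for e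
    using fixed_points_close_to_sphere[OF c that]
  proof eventually_elim
    case (elim t)
    have "z \<in> filled_Julia t c" if "F t c z = z" for z
      unfolding filled_Julia_eq using bounded_orbit_fixed_point[OF that] closure_subset by blast
    thus ?case using elim by blast
  qed
  show "hausdorff_limit (\<lambda>t. filled_Julia t c) (sphere 0 1)"
    by (rule hausdorff_limit_sphereI[where s = 0])
       (use filled_Julia_subset_cball filled_Julia_avoids_ball[OF c] K in auto)
  have "\<forall>\<^sub>F t in at_top. Julia t c \<inter> ball 0 r = {}" if "0 < r" "r < 1" for r
    using filled_Julia_avoids_ball[OF c that]
    by eventually_elim (use Julia_subset_filled_Julia in blast)
  thus "hausdorff_limit (\<lambda>t. Julia t c) (sphere 0 1)"
    by (intro hausdorff_limit_sphereI[where s = 0] Julia_subset_cball Julia_close_to_sphere K) auto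
qed

lemma hausdorff_limits_inside:
  assumes c: "norm c < 1"
  shows "hausdorff_limit (\<lambda>t. Julia t c) (sphere 0 1)"
    and "hausdorff_limit (\<lambda>t. filled_Julia t c) (cball 0 1)"
proof -
  show K: "hausdorff_limit (\<lambda>t. filled_Julia t c) (cball 0 1)"
    using filled_Julia_subset_cball c cball_subset_filled_Julia
    by (intro hausdorff_limit_cballI[where s = "norm c"]) auto
  have "\<forall>\<^sub>F t in at_top. \<forall>w\<in>sphere 0 1. \<exists>a\<in>filled_Julia t c. dist a w < e" if "e > 0" for e
    using K[unfolded hausdorff_limit_iff, rule_format, OF that] by eventually_elim auto
  hence near: "\<forall>\<^sub>F t in at_top. \<forall>w\<in>sphere 0 1. \<exists>a\<in>Julia t c. dist a w < e" if "e > 0" for e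
    using Julia_close_to_sphere that by blast
  have "\<forall>\<^sub>F t in at_top. Julia t c \<inter> ball 0 r = {}" if r: "0 < r" "norm c < r" "r < 1" for r
    using cball_subset_filled_Julia[OF r(1,3,2)]
  proof eventually_elim
    case (elim t)
    hence "ball 0 r \<subseteq> interior (filled_Julia t c)"
      by (intro interior_maximal) auto
    thus ?case unfolding Julia_def frontier_def by blast
  qed
  thus "hausdorff_limit (\<lambda>t. Julia t c) (sphere 0 1)"
    using c near by (intro hausdorff_limit_sphereI[where s = "norm c"] Julia_subset_cball) auto
qed

theorem proposition1p3:
  shows
    "hausdorff_limit Mandelbrot (cball 0 1)
   \<and> (\<forall>c. c \<notin> cball 0 1 \<longrightarrow>
        hausdorff_limit (\<lambda>t. Julia t c) (sphere 0 1)
      \<and> hausdorff_limit (\<lambda>t. filled_Julia t c) (sphere 0 1))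
   \<and> (\<forall>c. c \<in> ball 0 1 \<longrightarrow>
        hausdorff_limit (\<lambda>t. Julia t c) (sphere 0 1)
      \<and> hausdorff_limit (\<lambda>t. filled_Julia t c) (cball 0 1))
   \<and> (\<forall>c. c \<in> sphere 0 1 \<longrightarrow>
        (\<forall>L. hausdorff_limit (\<lambda>t. Julia t c) L \<longrightarrow> L \<subseteq> cball 0 1)
      \<and> (\<forall>L. hausdorff_limit (\<lambda>t. filled_Julia t c) L \<longrightarrow> L \<subseteq> cball 0 1)
      \<and> set_limsup (\<lambda>t. Julia t c) \<subseteq> cball 0 1
      \<and> set_liminf (\<lambda>t. Julia t c) \<subseteq> cball 0 1
      \<and> set_limsup (\<lambda>t. filled_Julia t c) \<subseteq> cball 0 1
      \<and> set_liminf (\<lambda>t. filled_Julia t c) \<subseteq> cball 0 1)"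
proof (intro conjI allI impI)
  show "hausdorff_limit Mandelbrot (cball 0 1)" by (rule hausdorff_limit_Mandelbrot)
next
  fix c :: complex assume "c \<notin> cball 0 1"
  hence c: "norm c > 1" by simp
  show "hausdorff_limit (\<lambda>t. Julia t c) (sphere 0 1)"
    and "hausdorff_limit (\<lambda>t. filled_Julia t c) (sphere 0 1)"
    by (fact hausdorff_limits_outside[OF c])+
next
  fix c :: complex assume "c \<in> ball 0 1"
  hence c: "norm c < 1" by simp
  show "hausdorff_limit (\<lambda>t. Julia t c) (sphere 0 1)"
    and "hausdorff_limit (\<lambda>t. filled_Julia t c) (cball 0 1)"
    by (fact hausdorff_limits_inside[OF c])+
next
  fix c :: complex
  show "L \<subseteq> cball 0 1" if "hausdorff_limit (\<lambda>t. Julia t c) L" for L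
    using that Julia_subset_cball by (rule hausdorff_limit_subset_cball)
  show "L \<subseteq> cball 0 1" if "hausdorff_limit (\<lambda>t. filled_Julia t c) L" for L
    using that filled_Julia_subset_cball by (rule hausdorff_limit_subset_cball)
  show J: "set_limsup (\<lambda>t. Julia t c) \<subseteq> cball 0 1"
    using Julia_subset_cball by (rule set_limsup_subset_cball)
  show K: "set_limsup (\<lambda>t. filled_Julia t c) \<subseteq> cball 0 1"
    using filled_Julia_subset_cball by (rule set_limsup_subset_cball)
  show "set_liminf (\<lambda>t. Julia t c) \<subseteq> cball 0 1"
    using set_liminf_subset_set_limsup J by (rule order_trans)
  show "set_liminf (\<lambda>t. filled_Julia t c) \<subseteq> cball 0 1"
    using set_liminf_subset_set_limsup K by (rule order_trans)
qed

end
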